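(* Let $G=(\mathcal{Y},E)$ be an undirected graph on the sample space $\mathcal{Y}$, with adjacency sets $b(y)=\{z\in\mathcal{Y}\mid (y,z)\in E\}$ and neighborhoods $n(y)=b(y)\cup\{y\}$. Let $\mathcal{Y}_0\subset\mathcal{Y}$ satisfy $\bigcup_{y\in\mathcal{Y}_0} n(y)=\mathcal{Y}$. Define the graph $G_0=(\mathcal{Y}_0,E_0)$ by $$(y,y')\in E_0\iff y\neq y'\ \text{and}\ n(y)\cap n(y')\neq\emptyset .$$ Assume that $G_0$ is connected and that every function in the collection of local potentials $\Phi=\{\phi_y:\mathbb{R}_{++}^{b(y)}\to\mathbb{R}\mid y\in\mathcal{Y}_0\}$ is strictly convex. Then the composite local Bregman divergence $D_\Phi$ satisfies the coincidence axiom on $\mathcal{P}$, i.e., for all $p,q\in\mathcal{P}$, $D_\Phi(p,q)=0$ implies $p=q$.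
   Context: $\mathcal{Y}$ is a finite discrete sample space. $\mathbb{R}_{++}=\{x\in\mathbb{R}\mid x>0\}$, and for an index set $A$, $\mathbb{R}_{++}^{A}$ is the set of functions $A\to\mathbb{R}_{++}$, written as vectors $(a_z)_{z\in A}$. $\mathcal{F}=\mathbb{R}_{++}^{\mathcal{Y}}$ and $\mathcal{P}=\{p\in\mathcal{F}\mid\sum_{y\in\mathcal{Y}}p_y=1\}$ (probability functions with all entries positive). Graphs are undirected ($(y,z)$ and $(z,y)$ denote the same edge) and have no loops. For $f\in\mathcal{F}$ and $y\in\mathcal{Y}$, $f_{b(y)}/f_y$ denotes the vector $(f_z/f_y)_{z\in b(y)}\in\mathbb{R}_{++}^{b(y)}$. Each local potential $\phi_y:\mathbb{R}_{++}^{b(y)}\to\mathbb{R}$ is a differentiable convex function. Its Bregman divergence is, for $u,v\in\mathbb{R}_{++}^{b(y)}$, $$D_{\phi_y}(u,v)=\phi_y(u)-\phi_y(v)-\sum_{z\in b(y)}\partial_z\phi_y(v)(u_z-v_z),$$ where $\partial_z$ is the partial derivative with respect to the coordinate indexed by $z$. The composite local Bregman divergence of $\Phi=\{\phi_y\mid y\in\mathcal{Y}_0\}$ is $$D_\Phi(f,g)=\sum_{y\in\mathcal{Y}_0}f_y\,D_{\phi_y}\big(f_{b(y)}/f_y,\;g_{b(y)}/g_y\big),\qquad f,g\in\mathcal{F}.$$ *)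

theory Defs
  imports "Graph_Theory.Digraph_Component" "HOL-Analysis.Analysis"
begin

text \<open>
  The sample space is a finite type \<open>'y\<close>. For an index set \<open>A\<close>, a vector indexed by \<open>A\<close>
  is represented in \<open>real ^ 'y\<close> by extending it by \<open>0\<close> outside \<open>A\<close>.
\<close>

definition pos_vecs :: "'y set \<Rightarrow> (real ^ 'y) set" where
  "pos_vecs A = {u. (\<forall>z\<in>A. u $ z > 0) \<and> (\<forall>z. z \<notin> A \<longrightarrow> u $ z = 0)}"

definition pos_probs :: "(real ^ 'y) set" where
  "pos_probs = {p \<in> pos_vecs UNIV. (\<Sum>y\<in>UNIV. p $ y) = 1}"

definition adj_set :: "'y pair_pre_digraph \<Rightarrow> 'y \<Rightarrow> 'y set" where
  "adj_set G y = {z \<in> pverts G. (y, z) \<in> parcs G}"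

definition nbhd :: "'y pair_pre_digraph \<Rightarrow> 'y \<Rightarrow> 'y set" where
  "nbhd G y = adj_set G y \<union> {y}"

definition overlap_graph :: "'y pair_pre_digraph \<Rightarrow> 'y set \<Rightarrow> 'y pair_pre_digraph" where
  "overlap_graph G Y0 =
     \<lparr> pverts = Y0,
       parcs = {(y, y'). y \<in> Y0 \<and> y' \<in> Y0 \<and> y \<noteq> y' \<and> nbhd G y \<inter> nbhd G y' \<noteq> {}} \<rparr>"

definition strictly_convex_on :: "'a::real_vector set \<Rightarrow> ('a \<Rightarrow> real) \<Rightarrow> bool" where
  "strictly_convex_on S f \<longleftrightarrow> convex S \<and>
     (\<forall>x\<in>S. \<forall>y\<in>S. \<forall>t. x \<noteq> y \<longrightarrow> 0 < t \<longrightarrow> t < 1 \<longrightarrow>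
        f ((1 - t) *\<^sub>R x + t *\<^sub>R y) < (1 - t) * f x + t * f y)"

text \<open>
  Only the values of \<open>\<phi>\<close> on \<open>pos_vecs A\<close> matter. This set is open in the coordinate subspace
  indexed by \<open>A\<close>, so differentiability within it is ordinary differentiability of a function
  of the coordinates in \<open>A\<close>.
\<close>

definition local_potential :: "'y set \<Rightarrow> (real ^ 'y::finite \<Rightarrow> real) \<Rightarrow> bool" where
  "local_potential A \<phi> \<longleftrightarrow> \<phi> differentiable_on pos_vecs A \<and> convex_on (pos_vecs A) \<phi>"

definition partial_deriv :: "'y \<Rightarrow> (real ^ 'y::finite \<Rightarrow> real) \<Rightarrow> real ^ 'y \<Rightarrow> real" where
  "partial_deriv z \<phi> v = deriv (\<lambda>t. \<phi> (v + t *\<^sub>R axis z 1)) 0"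

definition bregman :: "'y set \<Rightarrow> (real ^ 'y::finite \<Rightarrow> real) \<Rightarrow> real ^ 'y \<Rightarrow> real ^ 'y \<Rightarrow> real" where
  "bregman A \<phi> u v = \<phi> u - \<phi> v - (\<Sum>z\<in>A. partial_deriv z \<phi> v * (u $ z - v $ z))"

definition local_ratio :: "'y pair_pre_digraph \<Rightarrow> 'y \<Rightarrow> real ^ 'y \<Rightarrow> real ^ 'y" where
  "local_ratio G y f = (\<chi> z. if z \<in> adj_set G y then f $ z / f $ y else 0)"

definition composite_bregman ::
  "'y pair_pre_digraph \<Rightarrow> 'y set \<Rightarrow> ('y \<Rightarrow> real ^ 'y::finite \<Rightarrow> real) \<Rightarrow> real ^ 'y \<Rightarrow> real ^ 'y \<Rightarrow> real"
where
  "composite_bregman G Y0 \<Phi> f g =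
     (\<Sum>y\<in>Y0. f $ y * bregman (adj_set G y) (\<Phi> y) (local_ratio G y f) (local_ratio G y g))"

end

theory Submission
  imports Defs
begin

text \<open>
  A strictly convex differentiable function lies strictly above its tangent planes, so each local
  Bregman divergence is nonnegative and vanishes only on the diagonal. Hence \<open>D\<^sub>\<Phi>(p, q) = 0\<close> makes
  the local ratios of \<open>p\<close> and \<open>q\<close> agree at every \<open>y \<in> Y0\<close>, i.e. \<open>p\<^sub>z / q\<^sub>z\<close> is constant on each
  neighborhood \<open>n(y)\<close>. Overlapping neighborhoods share this constant, so by connectedness of the
  overlap graph \<open>p\<close> is a multiple of \<open>q\<close>, and the normalization makes them equal.
\<close>

text \<open>The chain rule for the affine map \<open>t\<close> to \<open>v + t *\<^sub>R w\<close>.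
  The set \<open>T\<close> is left general so that one-sided limits along a segment and two-sided
  partial derivatives are both covered.\<close>

lemma has_derivative_along_line:
  fixes f :: "'a::real_normed_vector \<Rightarrow> real"
  assumes "(f has_derivative D) (at v within S)"
    and "\<And>t. t \<in> T \<Longrightarrow> v + t *\<^sub>R w \<in> S"
  shows "((\<lambda>t. f (v + t *\<^sub>R w)) has_real_derivative D w) (at 0 within T)"
proof -
  have "((\<lambda>t. v + t *\<^sub>R w) has_derivative (\<lambda>t. t *\<^sub>R w)) (at 0 within T)"
    by (auto intro!: derivative_eq_intros)
  moreover have "(f has_derivative D) (at (v + 0 *\<^sub>R w) within (\<lambda>t. v + t *\<^sub>R w) ` T)"
    using assms by (auto intro: has_derivative_subset)
  ultimately have "((\<lambda>t. f (v + t *\<^sub>R w)) has_derivative (\<lambda>t. D (t *\<^sub>R w))) (at 0 within T)"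
    by (rule has_derivative_in_compose)
  moreover have "(\<lambda>t. D (t *\<^sub>R w)) = (*) (D w)"
    using has_derivative_linear[OF assms(1)] by (auto simp: linear_cmul)
  ultimately show ?thesis
    by (simp add: has_field_derivative_def)
qed

text \<open>Convexity bounds every difference quotient on the segment from \<open>v\<close> to
  \<open>u\<close> by \<open>f u - f v\<close>; letting \<open>t\<close> tend to 0 from the right
  gives the claim. \<open>S\<close> need not be open, so the derivative is taken within
  \<open>S\<close>.\<close>

lemma convex_on_above_tangent:
  fixes f :: "'a::real_normed_vector \<Rightarrow> real"
  assumes conv: "convex_on S f" and der: "(f has_derivative D) (at v within S)"
    and u: "u \<in> S" and v: "v \<in> S"
  shows "D (u - v) \<le> f u - f v"
proof -
  have line: "v + t *\<^sub>R (u - v) = (1 - t) *\<^sub>R v + t *\<^sub>R u" for t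
    by (simp add: algebra_simps)
  have "v + t *\<^sub>R (u - v) \<in> S" if "t \<in> {0..1}" for t
    unfolding line using convex_on_imp_convex[OF conv] u v that by (auto simp: convex_alt)
  then have "((\<lambda>t. f (v + t *\<^sub>R (u - v))) has_real_derivative D (u - v)) (at 0 within {0..1})"
    by (rule has_derivative_along_line[OF der])
  then have lim: "((\<lambda>t. (f (v + t *\<^sub>R (u - v)) - f v) / t) \<longlongrightarrow> D (u - v)) (at 0 within {0..1})"
    by (simp add: has_field_derivative_iff)
  have "(f (v + t *\<^sub>R (u - v)) - f v) / t \<le> f u - f v" if "0 < t" "t \<le> 1" for t
  proof -
    have "f (v + t *\<^sub>R (u - v)) \<le> (1 - t) * f v + t * f u"
      unfolding line using convex_onD[OF conv, of t v u] u v that by simp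
    then show ?thesis
      using that by (simp add: field_simps)
  qed
  then have "\<forall>\<^sub>F t in at 0 within {0..1}. (f (v + t *\<^sub>R (u - v)) - f v) / t \<le> f u - f v"
    by (auto simp: eventually_at_filter)
  moreover have "at (0::real) within {0..1} \<noteq> bot"
    by (simp add: at_within_Icc_at_right)
  ultimately show ?thesis
    using tendsto_upperbound[OF lim] by blast
qed

text \<open>Strictness comes from applying the weak tangent inequality to the midpoint of \<open>u\<close> and \<open>v\<close>.\<close>

lemma strictly_convex_on_above_tangent:
  fixes f :: "'a::real_normed_vector \<Rightarrow> real"
  assumes "convex_on S f" and strict: "strictly_convex_on S f"
    and der: "(f has_derivative D) (at v within S)"
    and "u \<in> S" "v \<in> S" "u \<noteq> v"
  shows "D (u - v) < f u - f v"
proof -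
  define m where "m = (1 - 1/2) *\<^sub>R v + (1/2) *\<^sub>R u"
  have "m \<in> S"
    using strict assms(4,5) unfolding m_def strictly_convex_on_def by (intro convexD_alt) auto
  have "f m < (1 - 1/2) * f v + (1/2) * f u"
    using strict assms(4-6) unfolding m_def strictly_convex_on_def
    by (elim conjE ballE allE[of _ "1/2"]) (auto simp: add.commute)
  moreover have "D (m - v) \<le> f m - f v"
    using convex_on_above_tangent[OF assms(1) der \<open>m \<in> S\<close> \<open>v \<in> S\<close>] .
  moreover have "m - v = (1/2) *\<^sub>R (u - v)"
    by (simp add: m_def algebra_simps flip: scaleR_left_distrib)
  then have "D (m - v) = D (u - v) / 2"
    using has_derivative_linear[OF der] by (simp add: linear_cmul)
  ultimately show ?thesis
    by simp
qed

text \<open>Although \<open>pos_vecs A\<close> is not open when \<open>A\<close> is a proper subset,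
  moving from \<open>v\<close> along an axis in \<open>A\<close> stays inside it for all
  \<open>t > - (v $ z)\<close>. This is an open neighborhood of 0, so the derivative within the set
  determines the two-sided \<open>deriv\<close>.\<close>

lemma partial_deriv_eq:
  fixes \<phi> :: "real ^ 'y::finite \<Rightarrow> real"
  assumes der: "(\<phi> has_derivative D) (at v within pos_vecs A)"
    and v: "v \<in> pos_vecs A" and z: "z \<in> A"
  shows "partial_deriv z \<phi> v = D (axis z 1)"
proof -
  have "v + t *\<^sub>R axis z 1 \<in> pos_vecs A" if "t \<in> {- (v $ z)<..}" for t
    using that v z by (auto simp: pos_vecs_def axis_def)
  then have "((\<lambda>t. \<phi> (v + t *\<^sub>R axis z 1)) has_real_derivative D (axis z 1))
      (at 0 within {- (v $ z)<..})"
    by (rule has_derivative_along_line[OF der])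
  moreover have "at 0 within {- (v $ z)<..} = at 0"
    using v z by (intro at_within_open) (auto simp: pos_vecs_def)
  ultimately show ?thesis
    unfolding partial_deriv_def by (simp add: DERIV_imp_deriv)
qed

text \<open>Both vectors vanish outside \<open>A\<close>, so \<open>u - v\<close> expands in the
  axes of \<open>A\<close> alone, and \<open>D\<close> is linear.\<close>

lemma sum_partial_deriv_eq:
  fixes \<phi> :: "real ^ 'y::finite \<Rightarrow> real"
  assumes der: "(\<phi> has_derivative D) (at v within pos_vecs A)"
    and u: "u \<in> pos_vecs A" and v: "v \<in> pos_vecs A"
  shows "(\<Sum>z\<in>A. partial_deriv z \<phi> v * (u $ z - v $ z)) = D (u - v)"
proof -
  have "u - v = (\<Sum>z\<in>UNIV. (u - v) $ z *\<^sub>R axis z 1)"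
    using basis_expansion[of "u - v"] unfolding scalar_mult_eq_scaleR by (rule sym)
  also have "\<dots> = (\<Sum>z\<in>A. (u - v) $ z *\<^sub>R axis z 1)"
    using u v by (intro sum.mono_neutral_right) (auto simp: pos_vecs_def)
  finally have "D (u - v) = D (\<Sum>z\<in>A. (u - v) $ z *\<^sub>R axis z 1)"
    by (rule arg_cong)
  also have "\<dots> = (\<Sum>z\<in>A. (u - v) $ z * D (axis z 1))"
    using has_derivative_linear[OF der] by (simp add: linear_sum linear_cmul)
  finally have "D (u - v) = (\<Sum>z\<in>A. (u - v) $ z * D (axis z 1))" .
  then show ?thesis
    using partial_deriv_eq[OF der v] by (simp add: mult.commute)
qed

lemma bregman_pos:
  fixes \<phi> :: "real ^ 'y::finite \<Rightarrow> real"
  assumes "local_potential A \<phi>" "strictly_convex_on (pos_vecs A) \<phi>"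
    and "u \<in> pos_vecs A" "v \<in> pos_vecs A" "u \<noteq> v"
  shows "0 < bregman A \<phi> u v"
proof -
  obtain D where D: "(\<phi> has_derivative D) (at v within pos_vecs A)"
    using assms(1,4) by (auto simp: local_potential_def differentiable_on_def differentiable_def)
  have "D (u - v) < \<phi> u - \<phi> v"
    using assms D by (intro strictly_convex_on_above_tangent) (auto simp: local_potential_def)
  then show ?thesis
    unfolding bregman_def sum_partial_deriv_eq[OF D assms(3,4)] by simp
qed

lemma bregman_self [simp]: "bregman A \<phi> u u = 0"
  by (simp add: bregman_def)

lemma local_ratio_in_pos_vecs:
  assumes "f \<in> pos_vecs UNIV"
  shows "local_ratio G y f \<in> pos_vecs (adj_set G y)"
  using assms by (auto simp: local_ratio_def pos_vecs_def)

text \<open>Cross-multiplying turns agreement of ratios within \<open>p\<close> and within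
  \<open>q\<close> into constancy of \<open>p / q\<close>. At \<open>z = y\<close> this is trivial,
  which extends it from \<open>adj_set\<close> to \<open>nbhd\<close>.\<close>

lemma local_ratio_eq_iff:
  assumes "p \<in> pos_vecs UNIV" "q \<in> pos_vecs UNIV"
  shows "local_ratio G y p = local_ratio G y q \<longleftrightarrow>
    (\<forall>z\<in>nbhd G y. p $ z / q $ z = p $ y / q $ y)"
proof -
  have "p $ z / p $ y = q $ z / q $ y \<longleftrightarrow> p $ z / q $ z = p $ y / q $ y" for z
  proof -
    have "p $ y > 0" "q $ y > 0" "q $ z > 0"
      using assms by (auto simp: pos_vecs_def)
    then show ?thesis
      by (simp add: field_simps)
  qed
  moreover have "q $ y > 0"
    using assms by (simp add: pos_vecs_def)
  ultimately show ?thesis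
    by (auto simp: local_ratio_def nbhd_def vec_eq_iff)
qed

text \<open>A zero sum of nonnegative terms has only zero terms, and the weights
  \<open>p $ y\<close> are positive.\<close>

lemma composite_bregman_eq_0_imp_local_ratio_eq:
  fixes Y0 :: "'y::finite set"
  assumes "\<And>y. y \<in> Y0 \<Longrightarrow> local_potential (adj_set G y) (\<Phi> y)"
    and "\<And>y. y \<in> Y0 \<Longrightarrow> strictly_convex_on (pos_vecs (adj_set G y)) (\<Phi> y)"
    and p: "p \<in> pos_vecs UNIV" and q: "q \<in> pos_vecs UNIV"
    and zero: "composite_bregman G Y0 \<Phi> p q = 0" and y: "y \<in> Y0"
  shows "local_ratio G y p = local_ratio G y q"
proof -
  let ?b = "\<lambda>y. bregman (adj_set G y) (\<Phi> y) (local_ratio G y p) (local_ratio G y q)"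
  have pos: "0 < ?b y" if "y \<in> Y0" "local_ratio G y p \<noteq> local_ratio G y q" for y
    using assms(1,2) local_ratio_in_pos_vecs[OF p] local_ratio_in_pos_vecs[OF q] that
    by (intro bregman_pos)
  have nonneg: "0 \<le> ?b y" if "y \<in> Y0" for y
    using pos[OF that] by (cases "local_ratio G y p = local_ratio G y q") (auto simp: less_imp_le)
  have p_pos: "0 < p $ y" for y
    using p by (simp add: pos_vecs_def)
  have "p $ y * ?b y = 0"
    using zero y nonneg p_pos unfolding composite_bregman_def
    by (subst (asm) sum_nonneg_eq_0_iff) (auto simp: less_imp_le)
  then show ?thesis
    using pos[OF y] p_pos[of y] by fastforce
qed

lemma connected_constant:
  fixes G :: "('a, 'b) pre_digraph"
  assumes "Digraph_Component.connected G" "u \<in> verts G" "v \<in> verts G"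
    and "\<And>x y. (x, y) \<in> arcs_ends G \<Longrightarrow> r x = r y"
  shows "r u = r v"
proof -
  have "(u, v) \<in> rtrancl_on (verts G) (symcl (arcs_ends G))"
    using assms(1-3) by (simp add: connected_conv)
  then show ?thesis
    by induction (use assms(4) in \<open>auto simp: symcl_def\<close>)
qed

theorem theorem3:
  fixes G :: "'y::finite pair_pre_digraph"
    and Y0 :: "'y set"
    and \<Phi> :: "'y \<Rightarrow> real ^ 'y \<Rightarrow> real"
  assumes "pair_graph G"
    and "pverts G = UNIV"
    and "Y0 \<subseteq> pverts G"
    and "(\<Union>y\<in>Y0. nbhd G y) = pverts G"
    and "Digraph_Component.connected (overlap_graph G Y0)"
    and "\<And>y. y \<in> Y0 \<Longrightarrow> local_potential (adj_set G y) (\<Phi> y)"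
    and "\<And>y. y \<in> Y0 \<Longrightarrow> strictly_convex_on (pos_vecs (adj_set G y)) (\<Phi> y)"
  shows "\<forall>p\<in>pos_probs. \<forall>q\<in>pos_probs. composite_bregman G Y0 \<Phi> p q = 0 \<longrightarrow> p = q"
proof (intro ballI impI)
  fix p q :: "real ^ 'y"
  assume "p \<in> pos_probs" "q \<in> pos_probs" and zero: "composite_bregman G Y0 \<Phi> p q = 0"
  then have p: "p \<in> pos_vecs UNIV" "(\<Sum>y\<in>UNIV. p $ y) = 1"
    and q: "q \<in> pos_vecs UNIV" "(\<Sum>y\<in>UNIV. q $ y) = 1"
    by (auto simp: pos_probs_def)
  have nbhd_const: "p $ z / q $ z = p $ y / q $ y" if "y \<in> Y0" "z \<in> nbhd G y" for y z
    using composite_bregman_eq_0_imp_local_ratio_eq[OF assms(6,7) p(1) q(1) zero] that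
    by (simp add: local_ratio_eq_iff[OF p(1) q(1)])
  have Y0_const: "p $ y / q $ y = p $ y' / q $ y'" if "y \<in> Y0" "y' \<in> Y0" for y y'
  proof (rule connected_constant[OF assms(5)])
    show "y \<in> verts (overlap_graph G Y0)" "y' \<in> verts (overlap_graph G Y0)"
      using that by (simp_all add: overlap_graph_def)
    show "p $ a / q $ a = p $ b / q $ b" if "(a, b) \<in> arcs_ends (overlap_graph G Y0)" for a b
    proof -
      \<comment> \<open>At a common neighbor \<open>z\<close>, the quotient
        \<open>p $ z / q $ z\<close> equals the constants of both neighborhoods.\<close>
      obtain z where "a \<in> Y0" "b \<in> Y0" "z \<in> nbhd G a" "z \<in> nbhd G b"
        using \<open>(a, b) \<in> _\<close> by (auto simp: overlap_graph_def)
      then show ?thesis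
        using nbhd_const by metis
    qed
  qed
  \<comment> \<open>\<open>Y0\<close> is nonempty because its neighborhoods cover the nonempty
    type.\<close>
  obtain y0 where "y0 \<in> Y0"
    using assms(2,4) by auto
  define c where "c = p $ y0 / q $ y0"
  have "p $ z = c * q $ z" for z
  proof -
    obtain y where "y \<in> Y0" "z \<in> nbhd G y"
      using assms(2,4) by auto
    then have "p $ z / q $ z = c"
      using nbhd_const Y0_const \<open>y0 \<in> Y0\<close> unfolding c_def by metis
    moreover have "q $ z > 0"
      using q(1) by (simp add: pos_vecs_def)
    ultimately show ?thesis
      by (auto simp: field_simps)
  qed
  \<comment> \<open>Summing over all \<open>z\<close> gives 1 on the left and \<open>c\<close> on
    the right.\<close>
  moreover from this have "c = 1"
    using p(2) q(2) by (simp flip: sum_distrib_left)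
  ultimately show "p = q"
    by (simp add: vec_eq_iff)
qed

end
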